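(* Let $n$ be a positive integer with $n\ge 10$. Then $r(K_{1,n-2},T_n^3)=r(K_{1,n-2},T_n'')=r(K_{1,n-2},T_n''')=2n-5$.
   Context: All graphs are finite simple graphs. For graphs $G_1,G_2$, the Ramsey number $r(G_1,G_2)$ is the smallest positive integer $N$ such that for every graph $G$ on $N$ vertices, either $G$ contains a (not necessarily induced) subgraph isomorphic to $G_1$, or the complement $\overline{G}$ contains a subgraph isomorphic to $G_2$. $K_{1,k}$ is the star with $k$ leaves. On vertex set $\{v_0,\ldots,v_{n-1}\}$: $T_n''$ has edges $v_0v_1,\ldots,v_0v_{n-4},v_1v_{n-3},v_1v_{n-2},v_2v_{n-1}$; $T_n'''$ has edges $v_0v_1,\ldots,v_0v_{n-4},v_1v_{n-3},v_2v_{n-2},v_3v_{n-1}$; $T_n^3$ has edges $v_0v_1,\ldots,v_0v_{n-4},v_{n-4}v_{n-3},v_{n-4}v_{n-2},v_{n-4}v_{n-1}$. *)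

theory Defs
  imports "HOL-Library.Ramsey"
begin

text \<open>
  A graph is a pair of a vertex set and a set of edges, an edge being a two-element set of
  vertices; \<open>[V]\<^bsup>2\<^esup>\<close> is the set of all two-element subsets of \<open>V\<close>.
\<close>

type_synonym 'a graph = "'a set \<times> 'a set set"

abbreviation verts :: "'a graph \<Rightarrow> 'a set" where "verts \<equiv> fst"
abbreviation edges :: "'a graph \<Rightarrow> 'a set set" where "edges \<equiv> snd"

definition finite_simple_graph :: "'a graph \<Rightarrow> bool" where
  "finite_simple_graph G \<longleftrightarrow> finite (verts G) \<and> edges G \<subseteq> [verts G]\<^bsup>2\<^esup>"

definition complement :: "'a graph \<Rightarrow> 'a graph" where
  "complement G = (verts G, [verts G]\<^bsup>2\<^esup> - edges G)"

definition subgraph :: "'a graph \<Rightarrow> 'a graph \<Rightarrow> bool" where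
  "subgraph H G \<longleftrightarrow>
     finite_simple_graph H \<and> verts H \<subseteq> verts G \<and> edges H \<subseteq> edges G"

definition isomorphic :: "'a graph \<Rightarrow> 'b graph \<Rightarrow> bool" where
  "isomorphic G H \<longleftrightarrow>
     (\<exists>f. bij_betw f (verts G) (verts H) \<and>
          (\<forall>x\<in>verts G. \<forall>y\<in>verts G. {x, y} \<in> edges G \<longleftrightarrow> {f x, f y} \<in> edges H))"

definition contains :: "'a graph \<Rightarrow> 'b graph \<Rightarrow> bool" where
  "contains G H \<longleftrightarrow> (\<exists>S. subgraph S G \<and> isomorphic S H)"

text \<open>
  Up to isomorphism every finite graph has its vertices in \<open>nat\<close>, so letting the graph \<open>G\<close>
  below range over graphs with natural-number vertices is no restriction.
\<close>

definition ramsey_number :: "'a graph \<Rightarrow> 'b graph \<Rightarrow> nat" where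
  "ramsey_number G1 G2 =
     (LEAST N. 0 < N \<and>
        (\<forall>G :: nat graph. finite_simple_graph G \<and> card (verts G) = N \<longrightarrow>
           contains G G1 \<or> contains (complement G) G2))"

text \<open>The star \<open>K\<^bsub>1,k\<^esub>\<close>, with centre \<open>0\<close>.\<close>

definition star :: "nat \<Rightarrow> nat graph" where
  "star k = ({0..k}, {{0, i} | i. i \<in> {1..k}})"

text \<open>
  The trees \<open>T\<^sub>n''\<close>, \<open>T\<^sub>n'''\<close> and \<open>T\<^sub>n\<^sup>3\<close>, in this order. The vertex \<open>i\<close> stands for
  \<open>v\<^sub>i\<close>. The definitions are meaningful only for \<open>n\<close> large enough that truncated
  subtraction plays no role and the listed vertices are distinct (\<open>n \<ge> 7\<close> suffices for all three).
\<close>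

definition T_double_prime :: "nat \<Rightarrow> nat graph" where
  "T_double_prime n =
     ({..<n}, {{0, i} | i. i \<in> {1..n - 4}} \<union> {{1, n - 3}, {1, n - 2}, {2, n - 1}})"

definition T_triple_prime :: "nat \<Rightarrow> nat graph" where
  "T_triple_prime n =
     ({..<n}, {{0, i} | i. i \<in> {1..n - 4}} \<union> {{1, n - 3}, {2, n - 2}, {3, n - 1}})"

definition T_super_three :: "nat \<Rightarrow> nat graph" where
  "T_super_three n =
     ({..<n}, {{0, i} | i. i \<in> {1..n - 4}} \<union>
        {{n - 4, n - 3}, {n - 4, n - 2}, {n - 4, n - 1}})"

lemma finite_simple_graph_star: "finite_simple_graph (star k)"
  by (auto simp: finite_simple_graph_def star_def)

lemma finite_simple_graph_trees:
  assumes "n \<ge> 7"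
  shows "finite_simple_graph (T_double_prime n)"
    and "finite_simple_graph (T_triple_prime n)"
    and "finite_simple_graph (T_super_three n)"
  using assms
  by (auto simp: finite_simple_graph_def T_double_prime_def T_triple_prime_def T_super_three_def)

end

(*
Lower bound: with at most 2n - 6 vertices, take a complete bipartite graph with both parts of size
at most n - 3. Its degrees are at most n - 3, and its complement consists of two cliques that are
too small for a connected graph on n vertices.

Upper bound: put m = n - 3. A graph on 2m + 1 vertices without the star has a complement H of
minimum degree at least m, so any two non-adjacent vertices of H have a common neighbour. Each of
the trees is a star with m - 1 leaves to which three edges are attached, and H offers plenty of
room for attaching edges greedily; the only danger is that the outer endpoints use up neighbours of
the centre u. If some degree is at least m + 2 there is no problem. If the degree of u is m + 1 or
m, it suffices to find one or two outer endpoints outside the neighbourhood of u, and counting the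
edges leaving that neighbourhood shows that this is possible for a suitable u.
*)
theory Submission
  imports Defs
begin

section \<open>Embeddings of graphs\<close>

text \<open>The image of \<open>T\<close>, taken with the image edges only, is the required
  subgraph, so further edges of \<open>G\<close> between image vertices do no harm.\<close>

lemma containsI:
  assumes T: "finite_simple_graph T" and inj: "inj_on g (verts T)"
    and V: "g ` verts T \<subseteq> verts G"
    and E: "\<And>x y. {x, y} \<in> edges T \<Longrightarrow> {g x, g y} \<in> edges G"
  shows "contains G T"
proof -
  let ?S = "(g ` verts T, (`) g ` edges T)"
  have Tsub: "e \<subseteq> verts T" "card e = 2" if "e \<in> edges T" for e
    using T that by (auto simp: finite_simple_graph_def nsets_def)
  have "edges ?S \<subseteq> [verts ?S]\<^bsup>2\<^esup>"
  proof
    fix e assume "e \<in> edges ?S"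
    then obtain d where d: "d \<in> edges T" "e = g ` d" by auto
    have "card e = 2"
      using Tsub[OF d(1)] d(2) inj by (metis card_image inj_on_subset)
    moreover have "finite e"
      using \<open>card e = 2\<close> card.infinite by fastforce
    ultimately show "e \<in> [verts ?S]\<^bsup>2\<^esup>"
      using Tsub(1)[OF d(1)] d(2) by (auto simp: nsets_def)
  qed
  moreover have "edges ?S \<subseteq> edges G"
  proof
    fix e assume "e \<in> edges ?S"
    then obtain d where d: "d \<in> edges T" "e = g ` d" by auto
    obtain x y where "d = {x, y}" using Tsub(2)[OF d(1)] by (auto simp: card_2_iff)
    then show "e \<in> edges G" using E d by auto
  qed
  ultimately have "subgraph ?S G"
    using T V by (auto simp: subgraph_def finite_simple_graph_def)
  moreover have "isomorphic ?S T"
    unfolding isomorphic_def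
  proof (intro exI conjI ballI)
    let ?f = "inv_into (verts T) g"
    show "bij_betw ?f (verts ?S) (verts T)"
      using inj by (simp add: bij_betw_inv_into inj_on_imp_bij_betw)
    fix x y assume "x \<in> verts ?S" "y \<in> verts ?S"
    then obtain a b where ab: "a \<in> verts T" "b \<in> verts T" "x = g a" "y = g b" by auto
    have "{a, b} \<in> edges T" if "{g a, g b} \<in> edges ?S"
    proof -
      have "{g a, g b} \<in> (`) g ` edges T" using that by simp
      then obtain d where d: "{g a, g b} = g ` d" "d \<in> edges T" by (rule imageE)
      then have "{a, b} = d"
        using inj_on_image_eq_iff[OF inj, of "{a, b}" d] ab Tsub(1) by auto
      then show ?thesis using d by simp
    qed
    moreover have "{g a, g b} \<in> edges ?S" if "{a, b} \<in> edges T"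
      using that by (auto intro!: image_eqI[of _ _ "{a, b}"])
    ultimately show "({x, y} \<in> edges ?S) = ({?f x, ?f y} \<in> edges T)"
      using ab inj by auto
  qed
  ultimately show ?thesis by (auto simp: contains_def)
qed

lemma containsE:
  assumes "contains G T" "finite_simple_graph T"
  obtains g where "inj_on g (verts T)" "g ` verts T \<subseteq> verts G"
    "\<And>x y. {x, y} \<in> edges T \<Longrightarrow> {g x, g y} \<in> edges G"
proof -
  obtain S f where S: "subgraph S G" and f: "bij_betw f (verts S) (verts T)"
    "\<forall>x\<in>verts S. \<forall>y\<in>verts S. {x, y} \<in> edges S \<longleftrightarrow> {f x, f y} \<in> edges T"
    using assms(1) by (auto simp: contains_def isomorphic_def)
  let ?g = "inv_into (verts S) f"
  have g: "bij_betw ?g (verts T) (verts S)" using f(1) by (rule bij_betw_inv_into)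
  show thesis
  proof (rule that)
    show "inj_on ?g (verts T)" using g by (simp add: bij_betw_def)
    show "?g ` verts T \<subseteq> verts G" using g S by (simp add: bij_betw_def subgraph_def)
    fix x y assume xy: "{x, y} \<in> edges T"
    then have "x \<in> verts T" "y \<in> verts T"
      using assms(2) by (auto simp: finite_simple_graph_def nsets_def)
    then have "?g x \<in> verts S" "?g y \<in> verts S" "f (?g x) = x" "f (?g y) = y"
      using g f(1) by (auto simp: bij_betw_def f_inv_into_f inv_into_into)
    then have "{?g x, ?g y} \<in> edges S" using f(2) xy by simp
    then show "{?g x, ?g y} \<in> edges G" using S by (auto simp: subgraph_def)
  qed
qed

text \<open>\<open>P\<close> and its image have equally many elements, so enough of \<open>B\<close>
  is left over for \<open>A - P\<close>. This later fills up the leaves of a star once those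
  carrying attached edges are fixed.\<close>

lemma inj_on_extend:
  assumes "inj_on p P" "P \<subseteq> A" "finite A" "finite B" "p ` P \<subseteq> B" "card A \<le> card B"
  obtains g where "inj_on g A" "g ` A \<subseteq> B" "\<And>i. i \<in> P \<Longrightarrow> g i = p i"
proof -
  have "finite P" using assms finite_subset by blast
  then have "card (A - P) \<le> card (B - p ` P)"
    using assms by (simp add: card_Diff_subset card_image)
  then obtain h where h: "h ` (A - P) \<subseteq> B - p ` P" "inj_on h (A - P)"
    using card_le_inj[of "A - P" "B - p ` P"] assms by auto
  show thesis
  proof (rule that)
    let ?g = "\<lambda>i. if i \<in> P then p i else h i"
    show "inj_on ?g A"
    proof (rule inj_onI)
      fix x y assume "x \<in> A" "y \<in> A" "?g x = ?g y"
      then show "x = y"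
        using h assms(1) by (auto split: if_splits simp: inj_on_def)
    qed
    show "?g ` A \<subseteq> B" using h assms by auto
  qed simp
qed

section \<open>Neighbourhoods\<close>

definition nbrs :: "'a graph \<Rightarrow> 'a \<Rightarrow> 'a set" where
  "nbrs G u = {v. {u, v} \<in> edges G}"

lemma nbrs_sym: "v \<in> nbrs G u \<longleftrightarrow> u \<in> nbrs G v"
  by (simp add: nbrs_def insert_commute)

lemma nbrs_subset:
  assumes "finite_simple_graph G"
  shows "nbrs G u \<subseteq> verts G - {u}"
proof
  fix v assume "v \<in> nbrs G u"
  then have "{u, v} \<in> [verts G]\<^bsup>2\<^esup>"
    using assms by (auto simp only: nbrs_def finite_simple_graph_def)
  then show "v \<in> verts G - {u}" unfolding doubleton_in_nsets_2 by auto
qed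

lemma finite_nbrs: "finite_simple_graph G \<Longrightarrow> finite (nbrs G u)"
  using nbrs_subset[of G u] by (auto simp: finite_simple_graph_def intro: finite_subset)

lemma finite_simple_graph_complement:
  "finite_simple_graph G \<Longrightarrow> finite_simple_graph (complement G)"
  by (auto simp: finite_simple_graph_def complement_def)

lemma nbrs_complement:
  assumes "u \<in> verts G"
  shows "nbrs (complement G) u = verts G - {u} - nbrs G u"
  using assms by (auto simp: nbrs_def complement_def)

text \<open>The leaves of a copy are \<open>k\<close> distinct neighbours of the image of the centre
  \<open>0\<close>, so avoiding the star amounts to a bound on the degrees.\<close>

lemma contains_star_iff:
  assumes G: "finite_simple_graph G" and "k > 0"
  shows "contains G (star k) \<longleftrightarrow> (\<exists>u\<in>verts G. k \<le> card (nbrs G u))"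
proof
  assume "contains G (star k)"
  then obtain g where g: "inj_on g {0..k}" "g ` {0..k} \<subseteq> verts G"
    "\<And>x y. {x, y} \<in> edges (star k) \<Longrightarrow> {g x, g y} \<in> edges G"
    by (rule containsE[OF _ finite_simple_graph_star]) (simp add: star_def)
  have "{g 0, g i} \<in> edges G" if "i \<in> {1..k}" for i
    by (rule g(3)) (use that in \<open>auto simp: star_def\<close>)
  then have "g ` {1..k} \<subseteq> nbrs G (g 0)" by (auto simp: nbrs_def)
  then have "card (g ` {1..k}) \<le> card (nbrs G (g 0))"
    using card_mono finite_nbrs[OF G] by blast
  moreover have "inj_on g {1..k}" by (rule inj_on_subset[OF g(1)]) auto
  then have "card (g ` {1..k}) = k" by (simp add: card_image)
  moreover have "g 0 \<in> verts G" using g(2) by auto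
  ultimately show "\<exists>u\<in>verts G. k \<le> card (nbrs G u)" by (intro bexI[of _ "g 0"]) simp_all
next
  assume "\<exists>u\<in>verts G. k \<le> card (nbrs G u)"
  then obtain u where u: "u \<in> verts G" "k \<le> card (nbrs G u)" by blast
  \<comment> \<open>With nothing prescribed, hence \<open>undefined\<close> on the empty set,
    \<open>inj_on_extend\<close> just chooses \<open>k\<close> distinct neighbours.\<close>
  obtain g where g: "inj_on g {1..k}" "g ` {1..k} \<subseteq> nbrs G u"
    using inj_on_extend[of undefined "{}" "{1..k}" "nbrs G u"] u finite_nbrs[OF G] by auto
  have sub: "nbrs G u \<subseteq> verts G - {u}" by (rule nbrs_subset[OF G])
  have g0: "g i \<in> nbrs G u" if "i \<in> {1..k}" for i using g that by auto
  show "contains G (star k)"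
  proof (rule containsI[OF finite_simple_graph_star])
    let ?g = "g(0 := u)"
    have eq: "verts (star k) = insert 0 {1..k}" by (auto simp: star_def)
    have img: "?g ` {1..k} = g ` {1..k}" by (rule image_cong) auto
    have "inj_on ?g {1..k}" using g(1) by (subst inj_on_cong[of _ ?g g]) auto
    moreover have "u \<notin> g ` {1..k}" using g(2) sub by blast
    ultimately show "inj_on ?g (verts (star k))"
      unfolding eq inj_on_insert using img by simp
    show "?g ` verts (star k) \<subseteq> verts G"
      unfolding eq image_insert img using g(2) sub u(1) by auto
    fix x y assume "{x, y} \<in> edges (star k)"
    then obtain i where "i \<in> {1..k}" "{x, y} = {0, i}"
      unfolding star_def snd_conv by blast
    then show "{?g x, ?g y} \<in> edges G"
      using g0[of i] by (auto simp: doubleton_eq_iff nbrs_def insert_commute)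
  qed
qed

section \<open>Embedding the trees around a given centre\<close>

text \<open>The vertex \<open>u\<close> is the image of \<open>0\<close>, and \<open>x1\<close>,
  \<open>x2\<close>, \<open>x3\<close> are those of \<open>n - 3\<close>, \<open>n - 2\<close>,
  \<open>n - 1\<close>. The three trees differ only in the leaves to which these outer vertices are
  attached; \<open>room\<close> leaves space for the \<open>n - 4\<close> leaves.\<close>

locale brooms =
  fixes G :: "'a graph" and n :: nat and u x1 x2 x3 :: 'a
  assumes G: "finite_simple_graph G" and n: "n \<ge> 8"
    and V: "u \<in> verts G" "x1 \<in> verts G" "x2 \<in> verts G" "x3 \<in> verts G"
    and dist: "distinct [u, x1, x2, x3]"
    and room: "n - 4 \<le> card (nbrs G u - {x1, x2, x3})"
begin

text \<open>The map \<open>p\<close> fixes the leaves that carry outer vertices, and the other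
  leaves are arbitrary. Nothing is claimed about the edges at the outer vertices, so the result
  serves all three trees.\<close>

lemma broom:
  assumes "inj_on p P" "P \<subseteq> {1..n - 4}" "p ` P \<subseteq> nbrs G u - {x1, x2, x3}"
  obtains g where "inj_on g {..<n}" "g ` {..<n} \<subseteq> verts G" "g 0 = u"
    "g (n - 3) = x1" "g (n - 2) = x2" "g (n - 1) = x3"
    "\<forall>i\<in>P. g i = p i" "\<forall>i\<in>{1..n - 4}. {u, g i} \<in> edges G"
proof -
  obtain h where h: "inj_on h {1..n - 4}" "h ` {1..n - 4} \<subseteq> nbrs G u - {x1, x2, x3}"
    "\<And>i. i \<in> P \<Longrightarrow> h i = p i"
    by (rule inj_on_extend[of p P "{1..n - 4}" "nbrs G u - {x1, x2, x3}"])
      (use assms room finite_nbrs[OF G] in auto)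
  have sub: "nbrs G u \<subseteq> verts G - {u}" by (rule nbrs_subset[OF G])
  define g where "g = h(0 := u, n - 3 := x1, n - 2 := x2, n - 1 := x3)"
  have gh: "g i = h i" if "i \<in> {1..n - 4}" for i
    using that n by (auto simp: g_def)
  have gx: "g 0 = u" "g (n - 3) = x1" "g (n - 2) = x2" "g (n - 1) = x3"
    using n by (auto simp: g_def)
  have img: "g ` {1..n - 4} = h ` {1..n - 4}" using gh by (rule image_cong[OF refl])
  have eq: "{..<n} = insert 0 (insert (n - 3) (insert (n - 2) (insert (n - 1) {1..n - 4})))"
    using n by auto
  show thesis
  proof (rule that[OF _ _ gx])
    have "inj_on g {1..n - 4} = inj_on h {1..n - 4}" using gh by (rule inj_on_cong)
    then have "inj_on g {1..n - 4}" using h(1) by blast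
    moreover have ne: "n - 3 \<noteq> 0" "n - 2 \<noteq> 0" "n - 1 \<noteq> 0" "n - 2 \<noteq> n - 3" "n - 1 \<noteq> n - 3"
      "n - 1 \<noteq> n - 2" using n by auto
    moreover have "{1..n - 4} - {i} = {1..n - 4}" if "i \<in> {0, n - 3, n - 2, n - 1}" for i
      using that n by auto
    moreover have "u \<notin> h ` {1..n - 4}" "x1 \<notin> h ` {1..n - 4}"
      "x2 \<notin> h ` {1..n - 4}" "x3 \<notin> h ` {1..n - 4}" using h(2) sub by blast+
    ultimately show "inj_on g {..<n}"
      unfolding eq inj_on_insert insert_Diff_if using dist
      by (simp add: ne gx img del: One_nat_def)
    show "g ` {..<n} \<subseteq> verts G"
      unfolding eq image_insert gx img using V h(2) sub by blast
    show "\<forall>i\<in>P. g i = p i" using h(3) gh assms(2) by auto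
    show "\<forall>i\<in>{1..n - 4}. {u, g i} \<in> edges G" using h(2) gh by (auto simp: nbrs_def)
  qed
qed

lemma contains_T_double_prime:
  assumes "v1 \<in> nbrs G u - {x1, x2, x3}" "v2 \<in> nbrs G u - {x1, x2, x3}" "v1 \<noteq> v2"
    and e: "x1 \<in> nbrs G v1" "x2 \<in> nbrs G v1" "x3 \<in> nbrs G v2"
  shows "contains G (T_double_prime n)"
proof -
  have "inj_on (\<lambda>i::nat. if i = 1 then v1 else v2) {1, 2}" "{1, 2} \<subseteq> {1..n - 4}"
    "(\<lambda>i::nat. if i = 1 then v1 else v2) ` {1, 2} \<subseteq> nbrs G u - {x1, x2, x3}"
    using n assms(1-3) by (auto simp: inj_on_def)
  note broom = broom[OF this]
  obtain g where g: "inj_on g {..<n}" "g ` {..<n} \<subseteq> verts G" "g 0 = u"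
    "g (n - 3) = x1" "g (n - 2) = x2" "g (n - 1) = x3"
    "\<forall>i\<in>{1, 2}. g i = (if i = 1 then v1 else v2)"
    "\<forall>i\<in>{1..n - 4}. {u, g i} \<in> edges G"
    by (rule broom) (rule that)
  have gv: "g 1 = v1" "g 2 = v2" using g(7) by auto
  show ?thesis
  proof (rule containsI)
    show "finite_simple_graph (T_double_prime n)"
      using n by (simp add: finite_simple_graph_trees)
    show "inj_on g (verts (T_double_prime n))" "g ` verts (T_double_prime n) \<subseteq> verts G"
      using g by (simp_all add: T_double_prime_def)
    fix x y assume "{x, y} \<in> edges (T_double_prime n)"
    then consider i where "i \<in> {1..n - 4}" "{x, y} = {0, i}" | "{x, y} = {1, n - 3}"
      | "{x, y} = {1, n - 2}" | "{x, y} = {2, n - 1}"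
      unfolding T_double_prime_def snd_conv by blast
    \<comment> \<open>Taking the image of the unordered pair avoids treating the two orders of
      \<open>x\<close> and \<open>y\<close> separately.\<close>
    then have "g ` {x, y} \<in> edges G"
    proof cases
      case 1
      then show ?thesis using g(3) bspec[OF g(8) 1(1)] by simp
    qed (use e gv g(3-6) in \<open>simp_all add: nbrs_def\<close>)
    then show "{g x, g y} \<in> edges G" by simp
  qed
qed

lemma contains_T_triple_prime:
  assumes "v1 \<in> nbrs G u - {x1, x2, x3}" "v2 \<in> nbrs G u - {x1, x2, x3}"
    "v3 \<in> nbrs G u - {x1, x2, x3}" "distinct [v1, v2, v3]"
    and e: "x1 \<in> nbrs G v1" "x2 \<in> nbrs G v2" "x3 \<in> nbrs G v3"
  shows "contains G (T_triple_prime n)"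
proof -
  let ?p = "\<lambda>i::nat. if i = 1 then v1 else if i = 2 then v2 else v3"
  have "inj_on ?p {1, 2, 3}" "{1, 2, 3} \<subseteq> {1..n - 4}"
    "?p ` {1, 2, 3} \<subseteq> nbrs G u - {x1, x2, x3}"
    using n assms(1-4) by (auto simp: inj_on_def)
  note broom = broom[OF this]
  obtain g where g: "inj_on g {..<n}" "g ` {..<n} \<subseteq> verts G" "g 0 = u"
    "g (n - 3) = x1" "g (n - 2) = x2" "g (n - 1) = x3"
    "\<forall>i\<in>{1, 2, 3}. g i = ?p i"
    "\<forall>i\<in>{1..n - 4}. {u, g i} \<in> edges G"
    by (rule broom) (rule that)
  have gv: "g 1 = v1" "g 2 = v2" "g 3 = v3" using g(7) by auto
  show ?thesis
  proof (rule containsI)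
    show "finite_simple_graph (T_triple_prime n)"
      using n by (simp add: finite_simple_graph_trees)
    show "inj_on g (verts (T_triple_prime n))" "g ` verts (T_triple_prime n) \<subseteq> verts G"
      using g by (simp_all add: T_triple_prime_def)
    fix x y assume "{x, y} \<in> edges (T_triple_prime n)"
    then consider i where "i \<in> {1..n - 4}" "{x, y} = {0, i}" | "{x, y} = {1, n - 3}"
      | "{x, y} = {2, n - 2}" | "{x, y} = {3, n - 1}"
      unfolding T_triple_prime_def snd_conv by blast
    then have "g ` {x, y} \<in> edges G"
    proof cases
      case 1
      then show ?thesis using g(3) bspec[OF g(8) 1(1)] by simp
    qed (use e gv g(3-6) in \<open>simp_all add: nbrs_def\<close>)
    then show "{g x, g y} \<in> edges G" by simp
  qed
qed

lemma contains_T_super_three: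
  assumes w: "w \<in> nbrs G u - {x1, x2, x3}"
    and e: "x1 \<in> nbrs G w" "x2 \<in> nbrs G w" "x3 \<in> nbrs G w"
  shows "contains G (T_super_three n)"
proof -
  have "inj_on (\<lambda>_. w) {n - 4}" "{n - 4} \<subseteq> {1..n - 4}"
    "(\<lambda>_. w) ` {n - 4} \<subseteq> nbrs G u - {x1, x2, x3}"
    using n w by (auto simp: inj_on_def)
  note broom = broom[OF this]
  obtain g where g: "inj_on g {..<n}" "g ` {..<n} \<subseteq> verts G" "g 0 = u"
    "g (n - 3) = x1" "g (n - 2) = x2" "g (n - 1) = x3"
    "\<forall>i\<in>{n - 4}. g i = w"
    "\<forall>i\<in>{1..n - 4}. {u, g i} \<in> edges G"
    by (rule broom) (rule that)
  show ?thesis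
  proof (rule containsI)
    show "finite_simple_graph (T_super_three n)"
      using n by (simp add: finite_simple_graph_trees)
    show "inj_on g (verts (T_super_three n))" "g ` verts (T_super_three n) \<subseteq> verts G"
      using g by (simp_all add: T_super_three_def)
    fix x y assume "{x, y} \<in> edges (T_super_three n)"
    then consider i where "i \<in> {1..n - 4}" "{x, y} = {0, i}" | "{x, y} = {n - 4, n - 3}"
      | "{x, y} = {n - 4, n - 2}" | "{x, y} = {n - 4, n - 1}"
      unfolding T_super_three_def snd_conv by blast
    then have "g ` {x, y} \<in> edges G"
    proof cases
      case 1
      then show ?thesis using g(3) bspec[OF g(8) 1(1)] by simp
    qed (use e g(3-7) in \<open>simp_all add: nbrs_def\<close>)
    then show "{g x, g y} \<in> edges G" by simp
  qed
qed

end

section \<open>Graphs on \<open>2m + 1\<close> vertices with minimum degree at least \<open>m\<close>\<close>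

text \<open>This describes the complement of a graph without the star, with
  \<open>m = n - 3\<close>; the bound \<open>m \<ge> 7\<close> is \<open>n \<ge> 10\<close>.\<close>

locale dense_graph =
  fixes G :: "'a graph" and m :: nat
  assumes G: "finite_simple_graph G" and m: "m \<ge> 7"
    and cV: "card (verts G) = 2 * m + 1"
    and deg: "\<And>u. u \<in> verts G \<Longrightarrow> m \<le> card (nbrs G u)"
begin

lemma finV: "finite (verts G)"
  using G by (simp add: finite_simple_graph_def)

lemma nbrD: "v \<in> nbrs G u \<Longrightarrow> v \<in> verts G \<and> v \<noteq> u"
  using nbrs_subset[OF G, of u] by auto

text \<open>At least seven neighbours cannot all be among six forbidden vertices; this is the greedy
  choice used throughout.\<close>

lemma pick_nbr:
  assumes "u \<in> verts G" "length F \<le> 6"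
  obtains x where "x \<in> nbrs G u" "x \<notin> set F"
proof -
  have "\<not> nbrs G u \<subseteq> set F"
  proof
    assume "nbrs G u \<subseteq> set F"
    then have "card (nbrs G u) \<le> length F"
      by (meson card_length card_mono finite_set le_trans)
    then show False using assms deg[of u] m by simp
  qed
  then show thesis using that by blast
qed

text \<open>Both neighbourhoods have at least \<open>m\<close> elements and lie in a set of
  \<open>2 * m - 1\<close>, so they meet.\<close>

lemma common_nbr:
  assumes "u \<in> verts G" "r \<in> verts G" "r \<noteq> u" "r \<notin> nbrs G u"
  obtains w where "w \<in> nbrs G u" "w \<in> nbrs G r"
proof -
  have "nbrs G u \<union> nbrs G r \<subseteq> verts G - {u, r}"
    using nbrs_subset[OF G] assms nbrs_sym[of u G r] by blast
  then have "card (nbrs G u \<union> nbrs G r) \<le> card (verts G - {u, r})"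
    using finV by (simp add: card_mono)
  also have "\<dots> = 2 * m - 1" using assms finV cV by (simp add: card_Diff_subset)
  finally have "nbrs G u \<inter> nbrs G r \<noteq> {}"
    using deg[of u] deg[of r] assms m finite_nbrs[OF G]
    by (auto simp: card_Un_disjoint)
  then show thesis using that by blast
qed

lemma card_non_nbrs:
  assumes "u \<in> verts G"
  shows "card (verts G - {u} - nbrs G u) = 2 * m - card (nbrs G u)"
  using assms nbrs_subset[OF G, of u] finite_nbrs[OF G, of u] finV cV
  by (simp add: card_Diff_subset)

text \<open>Each outer vertex costs the centre at most one available leaf.\<close>

lemma card_nbrs_Diff:
  "card (nbrs G u - A) \<le> card (nbrs G u - insert x A) + 1"
proof -
  have "nbrs G u - insert x A = (nbrs G u - A) - {x}" by auto
  then show ?thesis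
    using finite_nbrs[OF G, of u] by (simp add: card_Diff_singleton_if) arith
qed

text \<open>
  The first two of the three attached edges, placed so that one more neighbour of \<open>u\<close> may be
  used up by the third.
\<close>

lemma two_pendant_edges:
  obtains u v1 v2 x1 x2 where "u \<in> verts G" "v1 \<in> nbrs G u" "v2 \<in> nbrs G u"
    "x1 \<in> nbrs G v1" "x2 \<in> nbrs G v2" "distinct [u, v1, v2, x1, x2]"
    "m \<le> card (nbrs G u - {x1, x2})"
proof -
  \<comment> \<open>The cases record how many of the two outer vertices may be neighbours of
    \<open>u\<close>: both, one, or none.\<close>
  consider (a) u where "u \<in> verts G" "m + 2 \<le> card (nbrs G u)"
    | (b) u where "u \<in> verts G" "card (nbrs G u) = m + 1"
    | (c) "\<And>u. u \<in> verts G \<Longrightarrow> card (nbrs G u) = m"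
    using deg by (metis Suc_eq_plus1 add_2_eq_Suc' le_neq_implies_less not_less_eq_eq
        order_antisym_conv Suc_leI)
  then show thesis
  proof cases
    case a
    obtain v1 where v1: "v1 \<in> nbrs G u" using pick_nbr[OF a(1), of "[]"] by auto
    obtain v2 where v2: "v2 \<in> nbrs G u" "v2 \<noteq> v1" using pick_nbr[OF a(1), of "[v1]"] by auto
    obtain x1 where x1: "x1 \<in> nbrs G v1" "x1 \<notin> set [u, v2]"
      using pick_nbr[of v1 "[u, v2]"] nbrD v1 by auto
    obtain x2 where x2: "x2 \<in> nbrs G v2" "x2 \<notin> set [u, v1, x1]"
      using pick_nbr[of v2 "[u, v1, x1]"] nbrD v2 by auto
    have "m \<le> card (nbrs G u - {x1, x2})"
      using a card_nbrs_Diff[of u "{x2}" x1] card_nbrs_Diff[of u "{}" x2] by simp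
    moreover have "distinct [u, v1, v2, x1, x2]"
      using v2(2) x1(2) x2(2) nbrD[OF v1] nbrD[OF v2(1)] nbrD[OF x1(1)] nbrD[OF x2(1)] by auto
    ultimately show ?thesis using that[OF a(1) v1 v2(1) x1(1) x2(1)] by blast
  next
    case b
    \<comment> \<open>There are \<open>m - 1\<close> non-neighbours of \<open>u\<close>. Choosing
      \<open>x1\<close> among them costs nothing, so only \<open>x2\<close> can use up a
      neighbour.\<close>
    have "verts G - {u} - nbrs G u \<noteq> {}"
      using card_non_nbrs[OF b(1)] b(2) m by fastforce
    then obtain x1 where x1: "x1 \<in> verts G" "x1 \<noteq> u" "x1 \<notin> nbrs G u" by blast
    obtain v1 where v1: "v1 \<in> nbrs G u" "v1 \<in> nbrs G x1" using common_nbr[OF b(1) x1] .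
    obtain v2 where v2: "v2 \<in> nbrs G u" "v2 \<noteq> v1" using pick_nbr[OF b(1), of "[v1]"] by auto
    obtain x2 where x2: "x2 \<in> nbrs G v2" "x2 \<notin> set [u, v1, x1]"
      using pick_nbr[of v2 "[u, v1, x1]"] nbrD v2 by auto
    have "m \<le> card (nbrs G u - {x2, x1})"
      using b x1 card_nbrs_Diff[of u "{x1}" x2] by simp
    then have "m \<le> card (nbrs G u - {x1, x2})" by (simp add: insert_commute)
    moreover have "x1 \<in> nbrs G v1" using v1(2) by (simp add: nbrs_sym)
    moreover have "x1 \<noteq> v2" using x1(3) v2(1) by blast
    then have "distinct [u, v1, v2, x1, x2]"
      using v2(2) x1(2) x2(2) nbrD[OF v1(1)] nbrD[OF v1(2)] nbrD[OF v2(1)] nbrD[OF x2(1)] by auto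
    ultimately show ?thesis using that[OF b(1) v1(1) v2(1) _ x2(1)] by blast
  next
    case c
    obtain u where u: "u \<in> verts G" using cV by fastforce
    let ?R = "verts G - {u} - nbrs G u"
    have R: "card ?R = m" using card_non_nbrs[OF u] c[OF u] by simp
    have ex: "\<exists>w. w \<in> nbrs G u \<and> w \<in> nbrs G r" if "r \<in> ?R" for r
      using common_nbr[OF u, of r] that by blast
    show ?thesis
    proof (cases "\<exists>r1\<in>?R. \<exists>r2\<in>?R. \<exists>w1 w2. r1 \<noteq> r2 \<and> w1 \<noteq> w2 \<and> w1 \<in> nbrs G u \<and> w2 \<in> nbrs G u
        \<and> w1 \<in> nbrs G r1 \<and> w2 \<in> nbrs G r2")
      case True
      then obtain r1 r2 w1 w2 where r: "r1 \<in> ?R" "r2 \<in> ?R" "r1 \<noteq> r2" "w1 \<noteq> w2"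
        "w1 \<in> nbrs G u" "w2 \<in> nbrs G u" "w1 \<in> nbrs G r1" "w2 \<in> nbrs G r2" by blast
      have "nbrs G u - {r1, r2} = nbrs G u" using r by auto
      then have "m \<le> card (nbrs G u - {r1, r2})" using c[OF u] by simp
      moreover have "r1 \<in> nbrs G w1" "r2 \<in> nbrs G w2" using r(7,8) by (simp_all add: nbrs_sym)
      moreover have "distinct [u, w1, w2, r1, r2]"
        using r(1-6) nbrD[OF r(5)] nbrD[OF r(6)] nbrD[OF r(7)] nbrD[OF r(8)] by auto
      ultimately show ?thesis using that[OF u r(5,6)] by blast
    next
      \<comment> \<open>Now one vertex \<open>w\<close> links \<open>u\<close> to all its
        non-neighbours. Its degree is then at least \<open>m + 1\<close>, against
        regularity.\<close>
      case False
      have "?R \<noteq> {}" using R m by (metis card.empty not_numeral_le_zero)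
      then obtain r0 where r0: "r0 \<in> ?R" by blast
      obtain w where w: "w \<in> nbrs G u" "w \<in> nbrs G r0" using ex[OF r0] by blast
      have "w \<in> nbrs G r" if r: "r \<in> ?R" for r
      proof (cases "r = r0")
        case False
        obtain w' where "w' \<in> nbrs G u" "w' \<in> nbrs G r" using ex[OF r] by blast
        then show ?thesis using False \<open>\<not> (\<exists>r1\<in>?R. _ r1)\<close> r0 w r by metis
      qed (use w in simp)
      then have "insert u ?R \<subseteq> nbrs G w" using w nbrs_sym[of w G] by auto
      then have "card (insert u ?R) \<le> card (nbrs G w)"
        using finite_nbrs[OF G] by (rule card_mono[rotated])
      then show ?thesis using R finV c[of w] nbrD[OF w(1)] by simp
    qed
  qed
qed

text \<open>The counterpart for \<open>T_super_three\<close>, where all outer vertices hang on the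
  same neighbour \<open>w\<close> of the centre. Again one neighbour of \<open>u\<close> is kept in
  reserve for the third.\<close>

lemma nbr_with_two_pendants:
  obtains u w x1 x2 where "u \<in> verts G" "w \<in> nbrs G u"
    "x1 \<in> nbrs G w" "x2 \<in> nbrs G w" "distinct [u, w, x1, x2]"
    "m \<le> card (nbrs G u - {x1, x2})"
proof -
  consider (a) u where "u \<in> verts G" "m + 2 \<le> card (nbrs G u)"
    | (b) u where "u \<in> verts G" "card (nbrs G u) = m + 1"
    | (c) "\<And>u. u \<in> verts G \<Longrightarrow> card (nbrs G u) = m"
    using deg by (metis Suc_eq_plus1 add_2_eq_Suc' le_neq_implies_less not_less_eq_eq
        order_antisym_conv Suc_leI)
  then show thesis
  proof cases
    case a
    obtain w where w: "w \<in> nbrs G u" using pick_nbr[OF a(1), of "[]"] by auto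
    obtain x1 where x1: "x1 \<in> nbrs G w" "x1 \<noteq> u"
      using pick_nbr[of w "[u]"] nbrD w by auto
    obtain x2 where x2: "x2 \<in> nbrs G w" "x2 \<notin> set [u, x1]"
      using pick_nbr[of w "[u, x1]"] nbrD w by auto
    have "m \<le> card (nbrs G u - {x1, x2})"
      using a card_nbrs_Diff[of u "{x2}" x1] card_nbrs_Diff[of u "{}" x2] by simp
    moreover have "distinct [u, w, x1, x2]"
      using x1(2) x2(2) nbrD[OF w] nbrD[OF x1(1)] nbrD[OF x2(1)] by auto
    ultimately show ?thesis using that[OF a(1) w x1(1) x2(1)] by blast
  next
    case b
    have "verts G - {u} - nbrs G u \<noteq> {}"
      using card_non_nbrs[OF b(1)] b(2) m by fastforce
    then obtain x1 where x1: "x1 \<in> verts G" "x1 \<noteq> u" "x1 \<notin> nbrs G u" by blast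
    obtain w where w: "w \<in> nbrs G u" "w \<in> nbrs G x1" using common_nbr[OF b(1) x1] .
    obtain x2 where x2: "x2 \<in> nbrs G w" "x2 \<notin> set [u, x1]"
      using pick_nbr[of w "[u, x1]"] nbrD w by auto
    have "m \<le> card (nbrs G u - {x2, x1})"
      using b x1 card_nbrs_Diff[of u "{x1}" x2] by simp
    then have "m \<le> card (nbrs G u - {x1, x2})" by (simp add: insert_commute)
    moreover have "x1 \<in> nbrs G w" using w(2) by (simp add: nbrs_sym)
    moreover have "distinct [u, w, x1, x2]"
      using x1(2) x2(2) nbrD[OF w(1)] nbrD[OF w(2)] nbrD[OF x2(1)] by auto
    ultimately show ?thesis using that[OF b(1) w(1) _ x2(1)] by blast
  next
    case c
    obtain u where u: "u \<in> verts G" using cV by fastforce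
    let ?R = "verts G - {u} - nbrs G u"
    have R: "card ?R = m" using card_non_nbrs[OF u] c[OF u] by simp
    have "\<forall>r\<in>?R. \<exists>w. w \<in> nbrs G u \<and> w \<in> nbrs G r"
      using common_nbr[OF u] by blast
    then obtain f where f: "\<And>r. r \<in> ?R \<Longrightarrow> f r \<in> nbrs G u" "\<And>r. r \<in> ?R \<Longrightarrow> f r \<in> nbrs G r"
      by metis
    \<comment> \<open>Two non-neighbours of \<open>u\<close> with a shared link \<open>w\<close> can
      be the outer vertices at no cost.\<close>
    show ?thesis
    proof (cases "\<exists>w\<in>nbrs G u. \<exists>r1\<in>?R. \<exists>r2\<in>?R. r1 \<noteq> r2 \<and> w \<in> nbrs G r1 \<and> w \<in> nbrs G r2")
      case True
      then obtain w r1 r2 where r: "w \<in> nbrs G u" "r1 \<in> ?R" "r2 \<in> ?R" "r1 \<noteq> r2"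
        "w \<in> nbrs G r1" "w \<in> nbrs G r2" by blast
      have "nbrs G u - {r1, r2} = nbrs G u" using r by auto
      then have "m \<le> card (nbrs G u - {r1, r2})" using c[OF u] by simp
      moreover have "r1 \<in> nbrs G w" "r2 \<in> nbrs G w" using r(5,6) by (simp_all add: nbrs_sym)
      moreover have "distinct [u, w, r1, r2]"
        using r(2-4) nbrD[OF r(1)] nbrD[OF r(5)] nbrD[OF r(6)] by auto
      ultimately show ?thesis using that[OF u r(1)] by blast
    next
      text \<open>
        The edges between \<open>nbrs G u\<close> and the non-neighbours of \<open>u\<close> form a perfect matching,
        so any of these non-neighbours can serve as the centre instead of \<open>u\<close>.
      \<close>
      case False
      then have uniq: "r1 = r2" if "w \<in> nbrs G u" "r1 \<in> ?R" "r2 \<in> ?R"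
        "w \<in> nbrs G r1" "w \<in> nbrs G r2" for w r1 r2
        using that by blast
      have "inj_on f ?R"
        by (rule inj_onI) (use f uniq in metis)
      then have "card (f ` ?R) = card (nbrs G u)" using R c[OF u] by (simp add: card_image)
      then have onto: "f ` ?R = nbrs G u"
        using f(1) finite_nbrs[OF G] by (intro card_subset_eq) auto
      have "?R \<noteq> {}" using R m by (metis card.empty not_numeral_le_zero)
      then obtain r where r: "r \<in> ?R" by blast
      have fr: "f r \<in> nbrs G u" "f r \<in> nbrs G r" using f r by auto
      have rV: "r \<in> verts G" "r \<noteq> u" "r \<notin> nbrs G u" using r by auto
      obtain x where x: "x \<in> nbrs G (f r)" "x \<notin> set [u, r]"
        using pick_nbr[of "f r" "[u, r]"] nbrD[OF fr(1)] by auto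
      \<comment> \<open>Otherwise \<open>f r\<close> would be adjacent to two non-neighbours of
        \<open>u\<close>, namely \<open>r\<close> and \<open>x\<close>.\<close>
      have "x \<in> nbrs G u"
        using uniq[OF fr(1), of x r] x r fr(2) nbrD[OF x(1)] nbrs_sym[of x G "f r"] by auto
      then obtain r' where r': "r' \<in> ?R" "x = f r'" using onto by blast
      \<comment> \<open>The only non-neighbour of \<open>u\<close> adjacent to \<open>x\<close> is
        its partner \<open>r'\<close>; were this \<open>r\<close>, then \<open>x\<close> would equal
        \<open>f r\<close>, to which it is adjacent.\<close>
      have "x \<notin> nbrs G r"
      proof
        assume "x \<in> nbrs G r"
        then have "r = r'" using uniq[of x r r'] f r r' by auto
        then show False using r' x nbrD by blast
      qed
      \<comment> \<open>The new centre is \<open>r\<close>; its neighbour \<open>f r\<close> carries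
        \<open>u\<close> and \<open>x\<close>, both outside \<open>nbrs G r\<close>.\<close>
      moreover have "u \<notin> nbrs G r" using rV nbrs_sym[of u G r] by simp
      ultimately have "nbrs G r - {u, x} = nbrs G r" by auto
      then have "m \<le> card (nbrs G r - {u, x})" using c[OF rV(1)] by simp
      moreover have "u \<in> nbrs G (f r)" using fr(1) by (simp add: nbrs_sym)
      moreover have "distinct [r, f r, u, x]"
        using rV(2) x(2) nbrD[OF fr(1)] nbrD[OF fr(2)] nbrD[OF x(1)] by auto
      ultimately show ?thesis using that[OF rV(1) fr(2) _ x(1)] by blast
    qed
  qed
qed

text \<open>The third outer vertex is chosen greedily. It costs at most one neighbour of the centre,
  which leaves \<open>m - 1\<close> leaves, exactly as many as the tree on \<open>m + 3\<close>
  vertices needs.\<close>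

lemma contains_trees:
  shows "contains G (T_double_prime (m + 3))" "contains G (T_triple_prime (m + 3))"
    "contains G (T_super_three (m + 3))"
proof -
  obtain u v1 v2 x1 x2 where H: "u \<in> verts G" "v1 \<in> nbrs G u" "v2 \<in> nbrs G u"
    "x1 \<in> nbrs G v1" "x2 \<in> nbrs G v2" "distinct [u, v1, v2, x1, x2]"
    "m \<le> card (nbrs G u - {x1, x2})" using two_pendant_edges by blast
  have room: "m - 1 \<le> card (nbrs G u - {x3, x1, x2})" for x3
    using card_nbrs_Diff[of u "{x1, x2}" x3] H(7) by linarith
  {
    obtain x3 where x3: "x3 \<in> nbrs G v1" "x3 \<notin> set [u, v2, x1, x2]"
      using pick_nbr[of v1 "[u, v2, x1, x2]"] nbrD H by auto
    \<comment> \<open>Here \<open>x3\<close> takes the second place, because in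
      \<open>T_double_prime\<close> the first two outer vertices share a leaf, here
      \<open>v1\<close>.\<close>
    interpret brooms G "m + 3" u x1 x3 x2
      by unfold_locales
        (use G m H x3 nbrD room[of x3] in \<open>auto simp: insert_commute\<close>)
    show "contains G (T_double_prime (m + 3))"
      by (rule contains_T_double_prime[of v1 v2]) (use H x3 nbrD[OF x3(1)] in auto)
  }
  {
    \<comment> \<open>The third leaf must avoid \<open>x1\<close> and \<open>x2\<close> as well,
      since these may be neighbours of \<open>u\<close>.\<close>
    obtain v3 where v3: "v3 \<in> nbrs G u" "v3 \<notin> set [v1, v2, x1, x2]"
      using pick_nbr[of u "[v1, v2, x1, x2]"] H by auto
    obtain x3 where x3: "x3 \<in> nbrs G v3" "x3 \<notin> set [u, v1, v2, x1, x2]"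
      using pick_nbr[of v3 "[u, v1, v2, x1, x2]"] nbrD v3 by auto
    interpret brooms G "m + 3" u x1 x2 x3
      by unfold_locales
        (use G m H x3 nbrD room[of x3] in \<open>auto simp: insert_commute\<close>)
    show "contains G (T_triple_prime (m + 3))"
      by (rule contains_T_triple_prime[of v1 v2 v3]) (use H v3 x3 nbrD[OF x3(1)] in auto)
  }
  {
    obtain u w x1 x2 where H: "u \<in> verts G" "w \<in> nbrs G u"
      "x1 \<in> nbrs G w" "x2 \<in> nbrs G w" "distinct [u, w, x1, x2]"
      "m \<le> card (nbrs G u - {x1, x2})" using nbr_with_two_pendants by blast
    obtain x3 where x3: "x3 \<in> nbrs G w" "x3 \<notin> set [u, x1, x2]"
      using pick_nbr[of w "[u, x1, x2]"] nbrD H by auto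
    have room: "m - 1 \<le> card (nbrs G u - {x3, x1, x2})"
      using card_nbrs_Diff[of u "{x1, x2}" x3] H(6) by linarith
    interpret brooms G "m + 3" u x1 x2 x3
      by unfold_locales
        (use G m H x3 nbrD room in \<open>auto simp: insert_commute\<close>)
    show "contains G (T_super_three (m + 3))"
      by (rule contains_T_super_three[of w]) (use H x3 nbrD[OF x3(1)] in auto)
  }
qed

end

text \<open>Without the star all degrees in \<open>G\<close> are at most \<open>n - 3\<close>, so in
  the complement they are at least \<open>(2 * n - 6) - (n - 3) = n - 3\<close>.\<close>

lemma dense_graph_complement:
  fixes G :: "'a graph"
  assumes G: "finite_simple_graph G" and n: "n \<ge> 10" and c: "card (verts G) = 2 * n - 5"
    and star: "\<not> contains G (star (n - 2))"
  shows "dense_graph (complement G) (n - 3)"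
proof
  show "finite_simple_graph (complement G)" using G by (rule finite_simple_graph_complement)
  show "7 \<le> n - 3" using n by simp
  show "card (verts (complement G)) = 2 * (n - 3) + 1"
    using c n by (simp add: complement_def)
  fix u assume "u \<in> verts (complement G)"
  then have u: "u \<in> verts G" by (simp add: complement_def)
  then have "card (nbrs G u) < n - 2"
    using star contains_star_iff[OF G, of "n - 2"] n by auto
  moreover have "card (nbrs (complement G) u) = 2 * n - 6 - card (nbrs G u)"
    unfolding nbrs_complement[OF u] using u c G nbrs_subset[OF G, of u] finite_nbrs[OF G, of u]
    by (simp add: card_Diff_subset finite_simple_graph_def)
  ultimately show "n - 3 \<le> card (nbrs (complement G) u)" by simp
qed

section \<open>The lower bound\<close>

text \<open>For \<open>N \<le> k\<close> the second part is empty and there are no edges, so one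
  choice of \<open>k\<close> covers all small \<open>N\<close>.\<close>

definition complete_bipartite :: "nat \<Rightarrow> nat \<Rightarrow> nat graph" where
  "complete_bipartite k N = ({..<N}, {{x, y} | x y. x < k \<and> k \<le> y \<and> y < N})"

lemma complete_bipartite_edge_iff:
  "{x, y} \<in> edges (complete_bipartite k N) \<longleftrightarrow>
     x < k \<and> k \<le> y \<and> y < N \<or> y < k \<and> k \<le> x \<and> x < N"
  by (auto simp: complete_bipartite_def doubleton_eq_iff)

lemma finite_simple_graph_complete_bipartite:
  "finite_simple_graph (complete_bipartite k N)"
  by (auto simp: finite_simple_graph_def complete_bipartite_def)

text \<open>The neighbours of a vertex lie in the opposite part, and both parts have at most
  \<open>k\<close> elements.\<close>

lemma not_contains_star_complete_bipartite:
  assumes "N \<le> 2 * k"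
  shows "\<not> contains (complete_bipartite k N) (star (k + 1))"
proof -
  have "card (nbrs (complete_bipartite k N) u) \<le> k" for u
  proof (cases "u < k")
    case True
    then have "nbrs (complete_bipartite k N) u \<subseteq> {k..<N}"
      unfolding nbrs_def complete_bipartite_edge_iff by auto
    then have "card (nbrs (complete_bipartite k N) u) \<le> card {k..<N}"
      by (rule card_mono[rotated]) simp
    then show ?thesis using assms by simp
  next
    case False
    then have "nbrs (complete_bipartite k N) u \<subseteq> {..<k}"
      unfolding nbrs_def complete_bipartite_edge_iff by auto
    then have "card (nbrs (complete_bipartite k N) u) \<le> card {..<k}"
      by (rule card_mono[rotated]) simp
    then show ?thesis by simp
  qed
  then show ?thesis
    by (auto simp: contains_star_iff finite_simple_graph_complete_bipartite not_le le_imp_less_Suc)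
qed

text \<open>The last assumption expresses that \<open>T\<close> is connected.\<close>

lemma not_contains_complement_complete_bipartite:
  fixes T :: "'a graph"
  assumes T: "finite_simple_graph T" and "N \<le> 2 * k" "k < card (verts T)"
    and conn: "\<And>c :: 'a \<Rightarrow> bool. (\<And>x y. {x, y} \<in> edges T \<Longrightarrow> c x = c y) \<Longrightarrow>
      \<forall>x\<in>verts T. \<forall>y\<in>verts T. c x = c y"
  shows "\<not> contains (complement (complete_bipartite k N)) T"
proof
  assume "contains (complement (complete_bipartite k N)) T"
  then obtain g where g: "inj_on g (verts T)"
    "g ` verts T \<subseteq> verts (complement (complete_bipartite k N))"
    "\<And>x y. {x, y} \<in> edges T \<Longrightarrow> {g x, g y} \<in> edges (complement (complete_bipartite k N))"
    using containsE[OF _ T] by blast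
  have sub: "g ` verts T \<subseteq> {..<N}"
    using g(2) by (simp add: complement_def complete_bipartite_def)
  \<comment> \<open>No edge of the complement joins the two parts, so the part containing
    \<open>g x\<close> is constant along the edges of \<open>T\<close>, and by \<open>conn\<close>
    on all of \<open>T\<close>.\<close>
  have "(g x < k) = (g y < k)" if "{x, y} \<in> edges T" for x y
  proof -
    have "x \<in> verts T" "y \<in> verts T"
      using T that by (auto simp: finite_simple_graph_def nsets_def)
    then have "g x < N" "g y < N" using sub by auto
    moreover have "{g x, g y} \<notin> edges (complete_bipartite k N)"
      using g(3)[OF that] by (simp add: complement_def)
    ultimately show ?thesis unfolding complete_bipartite_edge_iff by auto
  qed
  then have "\<forall>x\<in>verts T. \<forall>y\<in>verts T. (g x < k) = (g y < k)" by (rule conn)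
  then have "g ` verts T \<subseteq> {..<k} \<or> g ` verts T \<subseteq> {k..<N}"
    using sub by (fastforce simp: not_less)
  then have "card (g ` verts T) \<le> k"
    using assms(2) card_mono[of "{..<k}" "g ` verts T"] card_mono[of "{k..<N}" "g ` verts T"]
    by auto
  then show False using assms(3) g(1) by (simp add: card_image)
qed

section \<open>Combining the two bounds\<close>

lemma ramsey_star_eq:
  fixes T :: "nat graph"
  assumes n: "n \<ge> 10" and T: "finite_simple_graph T" "verts T = {..<n}"
    and conn: "\<And>x. \<And>c :: nat \<Rightarrow> bool. (\<And>x y. {x, y} \<in> edges T \<Longrightarrow> c x = c y) \<Longrightarrow>
      x < n \<Longrightarrow> c x = c 0"
    and upper: "\<And>G :: nat graph. dense_graph G (n - 3) \<Longrightarrow> contains G T"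
  shows "ramsey_number (star (n - 2)) T = 2 * n - 5"
  unfolding ramsey_number_def
proof (rule Least_equality, intro conjI allI impI)
  show "0 < 2 * n - 5" using n by simp
  show "contains G (star (n - 2)) \<or> contains (complement G) T"
    if "finite_simple_graph G \<and> card (verts G) = 2 * n - 5" for G :: "nat graph"
    using that dense_graph_complement[of G n] n upper by blast
next
  fix N assume N: "0 < N \<and> (\<forall>G :: nat graph. finite_simple_graph G \<and> card (verts G) = N \<longrightarrow>
    contains G (star (n - 2)) \<or> contains (complement G) T)"
  show "2 * n - 5 \<le> N"
  \<comment> \<open>Every smaller \<open>N\<close> has to be refuted, not only
    \<open>2 * n - 6\<close>, because the property is not known to be monotone in
    \<open>N\<close>.\<close>
  proof (rule ccontr)
    assume "\<not> 2 * n - 5 \<le> N"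
    then have le: "N \<le> 2 * (n - 3)" using n by simp
    have "n - 2 = (n - 3) + 1" using n by simp
    then have "\<not> contains (complete_bipartite (n - 3) N) (star (n - 2))"
      using not_contains_star_complete_bipartite[OF le] by simp
    moreover have "\<not> contains (complement (complete_bipartite (n - 3) N)) T"
    proof (rule not_contains_complement_complete_bipartite[OF T(1) le])
      show "n - 3 < card (verts T)" using n T(2) by simp
      fix c :: "nat \<Rightarrow> bool"
      assume c: "\<And>x y. {x, y} \<in> edges T \<Longrightarrow> c x = c y"
      have "c x = c 0" if "x < n" for x
        by (rule conn[where c = c and x = x, OF _ that]) (rule c)
      then show "\<forall>x\<in>verts T. \<forall>y\<in>verts T. c x = c y" unfolding T(2) by blast
    qed
    moreover have "card (verts (complete_bipartite (n - 3) N)) = N"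
      by (simp add: complete_bipartite_def)
    ultimately show False using N finite_simple_graph_complete_bipartite by blast
  qed
qed

text \<open>Every vertex is \<open>0\<close>, a leaf, or attached to a leaf. The attachment leaves
  \<open>a1\<close>, \<open>a2\<close>, \<open>a3\<close> are \<open>n - 4\<close> three times for
  \<open>T_super_three\<close>, \<open>1, 1, 2\<close> for \<open>T_double_prime\<close> and
  \<open>1, 2, 3\<close> for \<open>T_triple_prime\<close>.\<close>

lemma broom_connected:
  fixes c :: "nat \<Rightarrow> bool"
  assumes c: "\<And>x y. {x, y} \<in> {{0, i} | i. i \<in> {1..n - 4}} \<union> {{a1, n - 3}, {a2, n - 2}, {a3, n - 1}}
      \<Longrightarrow> c x = c y"
    and a: "a1 \<in> {1..n - 4}" "a2 \<in> {1..n - 4}" "a3 \<in> {1..n - 4}" and x: "x < n"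
  shows "c x = c 0"
proof -
  have c0: "c i = c 0" if "i \<in> {1..n - 4}" for i using c[of 0 i] that by blast
  moreover have "c a1 = c (n - 3)" "c a2 = c (n - 2)" "c a3 = c (n - 1)"
    by (rule c; simp)+
  moreover consider "x = 0" | "x \<in> {1..n - 4}" | "x = n - 3" | "x = n - 2" | "x = n - 1"
    using x by fastforce
  ultimately show ?thesis using a by cases metis+
qed

theorem theorem4p7:
  fixes n :: nat
  assumes "n \<ge> 10"
  shows "ramsey_number (star (n - 2)) (T_super_three n) = 2 * n - 5
       \<and> ramsey_number (star (n - 2)) (T_double_prime n) = 2 * n - 5
       \<and> ramsey_number (star (n - 2)) (T_triple_prime n) = 2 * n - 5"
proof -
  have n7: "n \<ge> 7" and eq: "n - 3 + 3 = n" using assms by auto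
  note upper = dense_graph.contains_trees[where m = "n - 3", unfolded eq]
  have "ramsey_number (star (n - 2)) (T_super_three n) = 2 * n - 5"
  proof (rule ramsey_star_eq[OF assms finite_simple_graph_trees(3)[OF n7] _ _ upper(3)])
    fix c :: "nat \<Rightarrow> bool" and x
    assume c: "\<And>x y. {x, y} \<in> edges (T_super_three n) \<Longrightarrow> c x = c y" and x: "x < n"
    show "c x = c 0"
      by (rule broom_connected[OF c[unfolded T_super_three_def snd_conv] _ _ _ x]) (use assms in auto)
  qed (simp_all add: T_super_three_def)
  moreover have "ramsey_number (star (n - 2)) (T_double_prime n) = 2 * n - 5"
  proof (rule ramsey_star_eq[OF assms finite_simple_graph_trees(1)[OF n7] _ _ upper(1)])
    fix c :: "nat \<Rightarrow> bool" and x
    assume c: "\<And>x y. {x, y} \<in> edges (T_double_prime n) \<Longrightarrow> c x = c y" and x: "x < n"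
    show "c x = c 0"
      by (rule broom_connected[OF c[unfolded T_double_prime_def snd_conv] _ _ _ x]) (use assms in auto)
  qed (simp_all add: T_double_prime_def)
  moreover have "ramsey_number (star (n - 2)) (T_triple_prime n) = 2 * n - 5"
  proof (rule ramsey_star_eq[OF assms finite_simple_graph_trees(2)[OF n7] _ _ upper(2)])
    fix c :: "nat \<Rightarrow> bool" and x
    assume c: "\<And>x y. {x, y} \<in> edges (T_triple_prime n) \<Longrightarrow> c x = c y" and x: "x < n"
    show "c x = c 0"
      by (rule broom_connected[OF c[unfolded T_triple_prime_def snd_conv] _ _ _ x]) (use assms in auto)
  qed (simp_all add: T_triple_prime_def)
  ultimately show ?thesis by blast
qed

end
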